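(* In the downlink NOMA model of the context, for the special case with $K=1$, the connection outage probability (COP) $P_{m,PD}=\Pr(\gamma_m<\varepsilon_m)$ of the $m$-th user for PD-NOMA is given by $$P_{m,PD}\approx\phi_m\sum_{p=0}^{M-m}\binom{M-m}{p}\frac{(-1)^p}{m+p}\left[\sum_{u=1}^U b_u\left(1-e^{-\frac{\tau c_u}{\eta}}\right)\right]^{m+p},$$ where $\tau=\frac{\varepsilon_m}{\rho(a_m-\varepsilon_m a_n)}$ with $a_m>\varepsilon_m a_n$.
   Context: Downlink NOMA in a single cell: a base station (BS) at the centre of a disc of radius $R_D$ serves $M$ users whose locations form a homogeneous binomial point process in the disc (independent, uniformly distributed points). The data streams are mapped onto $K$ subcarriers by a sparse spreading matrix $\mathbf G$ of size $K\times M$, $M>K$, with few non-zero entries; its column for user $\varphi$ is $\mathbf g_\varphi=[g_{\varphi1},\dots,g_{\varphi K}]^T$, where $g_{\varphi k}=1$ or $0$ according to whether the signal is mapped onto subcarrier $k$ or not. The case $K\ne1$ is called CD-NOMA and $K=1$ (data streams of multiple users mapped into one subcarrier) PD-NOMA. The channel vector of user $\varphi$ is $\mathbf h_\varphi=[\tilde h_{\varphi1},\dots,\tilde h_{\varphi K}]^T$ with $\tilde h_{\varphi k}=\sqrt{\eta}\,h_{\varphi k}/\sqrt{1+d^\alpha}$, where $h_{\varphi k}\sim\mathcal{CN}(0,1)$ are independent (Rayleigh fading), $d$ is the distance from the BS to the user, $\eta>0$ is the frequency dependent factor and $\alpha>0$ the path loss exponent. Users are ordered so that $\|\mathbf h_M\|_2^2>\dots>\|\mathbf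 h_n\|_2^2>\dots>\|\mathbf h_m\|_2^2>\dots>\|\mathbf h_1\|_2^2$. Users $m$ and $n$ ($m<n$) are paired, with fixed power allocation coefficients $a_m>a_n$, $a_m+a_n=1$; $\mathbf g_m$ and $\mathbf g_n$ are assumed to have the same column weights. $\rho$ is the transmit SNR. The SINR of the $m$-th user decoding its own signal is $$\gamma_m=\frac{\rho\,\|\mathrm{diag}(\mathbf h_m)\mathbf g_m\|_2^2\,a_m}{\rho\,\|\mathrm{diag}(\mathbf h_m)\mathbf g_n\|_2^2\,a_n+1}.$$ $\varepsilon_m=2^{R_m}-1$, where $R_m$ is the target rate of the $m$-th user. Notation: $\phi_m=\frac{M!}{(M-m)!(m-1)!}$, $\theta_u=\cos\left(\frac{2u-1}{2U}\pi\right)$, $b_u=\frac{\pi}{2U}\sqrt{1-\theta_u^2}\,(\theta_u+1)$, $c_u=1+\left(\frac{R_D}{2}(\theta_u+1)\right)^\alpha$. The sign $\approx$ denotes an approximation (Gauss–Chebyshev quadrature with $U$ terms); $U$ is a parameter ensuring a complexity–accuracy tradeoff. *)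

theory Defs
  imports "HOL-Probability.Probability"
begin

text \<open>
  The plane is identified with the complex numbers, with the base station at the origin; locations
  and fading coefficients then have the same type and can be put in one independent family.
  Users and subcarriers are numbered from 1.  A vector over the subcarriers is a function on
  \<^term>\<open>{1..K}\<close>.
\<close>

definition CN01 :: "complex measure" where
  "CN01 = density lborel
     (\<lambda>z. ennreal (normal_density 0 (sqrt (1/2)) (Re z) * normal_density 0 (sqrt (1/2)) (Im z)))"

definition sqnorm :: "nat \<Rightarrow> (nat \<Rightarrow> complex) \<Rightarrow> real" where
  "sqnorm K v = (L2_set (\<lambda>k. cmod (v k)) {1..K})\<^sup>2"

definition diag_mult :: "(nat \<Rightarrow> complex) \<Rightarrow> (nat \<Rightarrow> real) \<Rightarrow> nat \<Rightarrow> complex" where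
  "diag_mult v g = (\<lambda>k. v k * complex_of_real (g k))"

definition channel ::
  "real \<Rightarrow> real \<Rightarrow> (nat \<Rightarrow> 'w \<Rightarrow> complex) \<Rightarrow> (nat \<Rightarrow> nat \<Rightarrow> 'w \<Rightarrow> complex) \<Rightarrow> nat \<Rightarrow> 'w \<Rightarrow> nat \<Rightarrow> complex"
where
  "channel \<eta> \<alpha> X h j \<omega> =
     (\<lambda>k. complex_of_real (sqrt \<eta>) * h j k \<omega> / complex_of_real (sqrt (1 + norm (X j \<omega>) powr \<alpha>)))"

text \<open>
  The users' labels 1, ..., M come from sorting the physical users by increasing channel norm.
  The ordering is strict almost surely; on the null event of ties the sort keeps the original order.
\<close>

definition ordered_channel ::
  "nat \<Rightarrow> nat \<Rightarrow> real \<Rightarrow> real \<Rightarrow> (nat \<Rightarrow> 'w \<Rightarrow> complex) \<Rightarrow> (nat \<Rightarrow> nat \<Rightarrow> 'w \<Rightarrow> complex)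
    \<Rightarrow> nat \<Rightarrow> 'w \<Rightarrow> nat \<Rightarrow> complex"
where
  "ordered_channel M K \<eta> \<alpha> X h i \<omega> =
     channel \<eta> \<alpha> X h
       (sort_key (\<lambda>j. sqnorm K (channel \<eta> \<alpha> X h j \<omega>)) [1..<Suc M] ! (i - 1)) \<omega>"

text \<open>
  The SINR of a user with channel vector \<open>v\<close>, spreading column \<open>g\<close> and power coefficient \<open>a\<close>
  that decodes its own signal in the presence of its partner's (\<open>g'\<close>, \<open>a'\<close>).
\<close>

definition sinr ::
  "nat \<Rightarrow> real \<Rightarrow> (nat \<Rightarrow> complex) \<Rightarrow> (nat \<Rightarrow> real) \<Rightarrow> real \<Rightarrow> (nat \<Rightarrow> real) \<Rightarrow> real \<Rightarrow> real"
where
  "sinr K \<rho> v g a g' a' =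
     \<rho> * sqnorm K (diag_mult v g) * a / (\<rho> * sqnorm K (diag_mult v g') * a' + 1)"

text \<open>
  \<open>X\<close>, \<open>h\<close> are indexed by the physical users, \<open>G k i\<close> by subcarrier and (ordered) user label.
  Every column of \<open>G\<close> is nonzero: each data stream is mapped onto some subcarrier.
\<close>

locale downlink_noma = prob_space \<Omega> for \<Omega> :: "'w measure" +
  fixes M K :: nat and R\<^sub>D \<eta> \<alpha> \<rho> :: real
    and X :: "nat \<Rightarrow> 'w \<Rightarrow> complex"
    and h :: "nat \<Rightarrow> nat \<Rightarrow> 'w \<Rightarrow> complex"
    and G :: "nat \<Rightarrow> nat \<Rightarrow> real"
    and m n :: nat and a\<^sub>m a\<^sub>n :: real
  assumes sizes: "1 \<le> K" "K < M"
    and positive: "0 < R\<^sub>D" "0 < \<eta>" "0 < \<alpha>" "0 < \<rho>"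
    and location: "\<And>j. j \<in> {1..M} \<Longrightarrow> distr \<Omega> borel (X j) = uniform_measure lborel (cball 0 R\<^sub>D)"
    and fading: "\<And>j k. j \<in> {1..M} \<Longrightarrow> k \<in> {1..K} \<Longrightarrow> distr \<Omega> borel (h j k) = CN01"
    and indep: "indep_vars (\<lambda>_. borel) (case_sum X (\<lambda>(j, k). h j k)) ({1..M} <+> {1..M} \<times> {1..K})"
    and spreading: "\<And>k i. k \<in> {1..K} \<Longrightarrow> i \<in> {1..M} \<Longrightarrow> G k i \<in> {0, 1}"
      "\<And>i. i \<in> {1..M} \<Longrightarrow> \<exists>k\<in>{1..K}. G k i = 1"
    and pair: "1 \<le> m" "m < n" "n \<le> M"
    and weights: "(\<Sum>k=1..K. G k m) = (\<Sum>k=1..K. G k n)"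
    and power: "0 \<le> a\<^sub>n" "a\<^sub>n < a\<^sub>m" "a\<^sub>m + a\<^sub>n = 1"

definition phi :: "nat \<Rightarrow> nat \<Rightarrow> real" where
  "phi M m = fact M / (fact (M - m) * fact (m - 1))"

definition theta :: "nat \<Rightarrow> nat \<Rightarrow> real" where
  "theta U u = cos ((2 * real u - 1) / (2 * real U) * pi)"

definition gc_b :: "nat \<Rightarrow> nat \<Rightarrow> real" where
  "gc_b U u = pi / (2 * real U) * sqrt (1 - (theta U u)\<^sup>2) * (theta U u + 1)"

definition gc_c :: "real \<Rightarrow> real \<Rightarrow> nat \<Rightarrow> nat \<Rightarrow> real" where
  "gc_c R\<^sub>D \<alpha> U u = 1 + (R\<^sub>D / 2 * (theta U u + 1)) powr \<alpha>"

end

theory Submission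
  imports Defs
begin

text \<open>
  For a single subcarrier the SINR is increasing in the channel gain, so user \<open>m\<close> is in outage iff
  the \<open>m\<close>-th smallest of the \<open>M\<close> gains is below \<open>\<tau>\<close>, i.e. iff at least \<open>m\<close> gains are.  The gains
  are independent, each below \<open>\<tau>\<close> with the same probability \<open>F\<close>, so the outage probability is
  a binomial tail, which is the stated polynomial in \<open>F\<close>.
  Under Lebesgue measure on the plane the squared modulus has constant density \<open>pi\<close>; hence
  the squared modulus of the fading coefficient is exponentially distributed, that of the location
  is uniform on \<open>{0..R\<^sub>D\<^sup>2}\<close>, and \<open>F\<close> is an integral over this interval.  After the substitution
  \<open>r = R\<^sub>D / 2 * (cos t + 1)\<close> of the radius, the Gauss--Chebyshev sums are the midpoint sums of
  that integral over \<open>{0..pi}\<close>.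
\<close>

section \<open>Convergence of midpoint sums\<close>

text \<open>By the mean value theorem the increment of \<open>F\<close> over a cell is the cell
  width times a value of \<open>f\<close> in that cell, and uniform continuity compares this value
  with the one at the midpoint. With an antiderivative \<open>F\<close> in the hypotheses, a later
  change of variables reduces to the chain rule.\<close>

lemma midpoint_sums_tendsto:
  fixes F f :: "real \<Rightarrow> real"
  assumes ab: "a < b"
    and F: "\<And>x. a \<le> x \<Longrightarrow> x \<le> b \<Longrightarrow> (F has_real_derivative f x) (at x within {a..b})"
    and f: "continuous_on {a..b} f"
  shows "(\<lambda>U. (b - a) / real U * (\<Sum>u=1..U. f (a + (2 * real u - 1) / (2 * real U) * (b - a))))
           \<longlonglongrightarrow> F b - F a"
proof (rule LIMSEQ_I)
  fix e :: real assume e: "0 < e"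
  have "uniformly_continuous_on {a..b} f"
    by (simp add: compact_uniformly_continuous f)
  \<comment> \<open>The cell widths add up to \<open>b - a\<close>, so this tolerance gives a total
    error of at most \<open>e / 2\<close>, hence strictly below \<open>e\<close>.\<close>
  then obtain d where d: "d > 0" and
    fd: "\<And>x y. x \<in> {a..b} \<Longrightarrow> y \<in> {a..b} \<Longrightarrow> dist y x < d \<Longrightarrow> dist (f y) (f x) < e / (2 * (b - a))"
    unfolding uniformly_continuous_on_def using e ab
    by (metis divide_pos_pos diff_gt_0_iff_gt zero_less_mult_iff zero_less_numeral)
  obtain N :: nat where N: "(b - a) / d < real N" using reals_Archimedean2 by blast
  show "\<exists>N0. \<forall>U\<ge>N0. norm ((b - a) / real U *
      (\<Sum>u=1..U. f (a + (2 * real u - 1) / (2 * real U) * (b - a))) - (F b - F a)) < e"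
  \<comment> \<open>\<open>Suc N\<close> rather than \<open>N\<close> excludes \<open>U = 0\<close>,
    where the mesh width would be a division by zero.\<close>
  proof (intro exI[of _ "Suc N"] allI impI)
    fix U assume U: "Suc N \<le> U"
    define s where "s = (b - a) / real U"
    define x where "x u = a + real u * s" for u :: nat
    define y where "y u = a + (2 * real u - 1) / (2 * real U) * (b - a)" for u :: nat
    have U0: "U > 0" using U by simp
    have "(b - a) / d < real U" using N U by linarith
    then have sd: "s < d" using d U0 by (simp add: s_def field_simps)
    have s0: "s > 0" using ab U0 by (simp add: s_def)
    have Us: "real U * s = b - a" using U0 by (simp add: s_def)
    \<comment> \<open>The nodes are counted from 1: \<open>y (Suc u)\<close> is the midpoint of the
      cell from \<open>x u\<close> to \<open>x (Suc u)\<close>.\<close>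
    have y_eq: "y u = a + (real u - 1 / 2) * s" for u
      using U0 by (simp add: y_def s_def field_simps)
    have step: "\<bar>F (x (Suc u)) - F (x u) - s * f (y (Suc u))\<bar> \<le> s * (e / (2 * (b - a)))"
      if u: "u < U" for u
    proof -
      have le: "a \<le> x u" "x (Suc u) \<le> b" "x u < x (Suc u)"
      proof -
        show "a \<le> x u" using s0 by (simp add: x_def)
        have "real (Suc u) * s \<le> real U * s" using u s0 by (intro mult_right_mono) auto
        then show "x (Suc u) \<le> b" using Us by (simp add: x_def)
        show "x u < x (Suc u)" using s0 by (simp add: x_def algebra_simps)
      qed
      have "\<exists>z\<in>{x u<..<x (Suc u)}. F (x (Suc u)) - F (x u) = f z * (x (Suc u) - x u)"
      proof (rule mvt_simple[OF le(3)])
        fix z assume "x u \<le> z" "z \<le> x (Suc u)"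
        then have "(F has_real_derivative f z) (at z within {x u..x (Suc u)})"
          using le by (intro DERIV_subset[OF F]) auto
        then show "(F has_derivative (*) (f z)) (at z within {x u..x (Suc u)})"
          by (simp add: has_field_derivative_def)
      qed
      then obtain z where z: "x u < z" "z < x (Suc u)"
        "F (x (Suc u)) - F (x u) = f z * (x (Suc u) - x u)" by auto
      have ys: "x u < y (Suc u)" "y (Suc u) < x (Suc u)"
        using s0 by (auto simp: y_eq x_def algebra_simps)
      have xs: "x (Suc u) - x u = s" by (simp add: x_def algebra_simps)
      have "dist (f z) (f (y (Suc u))) < e / (2 * (b - a))"
        using z ys le xs sd by (intro fd) (auto simp: dist_real_def)
      then have "s * \<bar>f z - f (y (Suc u))\<bar> \<le> s * (e / (2 * (b - a)))"
        using s0 by (intro mult_left_mono) (auto simp: dist_real_def)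
      moreover have "F (x (Suc u)) - F (x u) - s * f (y (Suc u)) = s * (f z - f (y (Suc u)))"
        unfolding z(3) xs by (simp add: algebra_simps)
      ultimately show ?thesis
        using s0 by (simp only: abs_mult abs_of_pos)
    qed
    have "F b - F a = (\<Sum>u<U. F (x (Suc u)) - F (x u))"
      using Us by (subst sum_lessThan_telescope) (simp add: x_def)
    moreover have "(\<Sum>u=1..U. f (y u)) = (\<Sum>u<U. f (y (Suc u)))"
      by (simp add: sum.atLeast1_atMost_eq)
    ultimately have "F b - F a - s * (\<Sum>u=1..U. f (y u)) =
        (\<Sum>u<U. F (x (Suc u)) - F (x u) - s * f (y (Suc u)))"
      by (simp add: sum_subtractf sum_distrib_left)
    also have "\<bar>\<dots>\<bar> \<le> (\<Sum>u<U. s * (e / (2 * (b - a))))"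
      using step by (intro order_trans[OF sum_abs] sum_mono) auto
    also have "\<dots> = (real U * s) * (e / (2 * (b - a)))" by simp
    also have "\<dots> = e / 2" unfolding Us using ab by (simp add: field_simps)
    finally show "norm ((b - a) / real U *
      (\<Sum>u=1..U. f (a + (2 * real u - 1) / (2 * real U) * (b - a))) - (F b - F a)) < e"
      using e unfolding y_def s_def by (simp add: abs_minus_commute)
  qed
qed

section \<open>Squared moduli of fading and location\<close>

text \<open>The two measures are compared on the rays \<open>{x<..}\<close>, which must have finite
  measure. The minus sign ensures this: the preimage of such a ray is an open disc of area
  \<open>pi * (- x)\<close>, or empty, instead of the unbounded complement of a disc.\<close>

lemma distr_lborel_uminus_cmod_power2:
  "distr lborel borel (\<lambda>z::complex. - (cmod z)\<^sup>2) = density lborel (\<lambda>t. ennreal pi * indicator {..0} t)"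
    (is "?L = ?R")
proof (rule measure_eqI_lessThan)
  have L: "emeasure ?L {x<..} = ennreal (pi * max 0 (- x))" for x
  proof -
    have "emeasure ?L {x<..} = emeasure lborel ((\<lambda>z::complex. - (cmod z)\<^sup>2) -` {x<..})"
      by (subst emeasure_distr) auto
    also have "(\<lambda>z::complex. - (cmod z)\<^sup>2) -` {x<..} = (if x < 0 then ball 0 (sqrt (- x)) else {})"
    proof -
      have "x < - (cmod z)\<^sup>2 \<longleftrightarrow> x < 0 \<and> cmod z < sqrt (- x)" for z
      proof -
        have "cmod z < sqrt (- x) \<longleftrightarrow> (cmod z)\<^sup>2 < - x"
          by (metis norm_ge_zero real_sqrt_less_iff real_sqrt_unique)
        moreover have "x < - (cmod z)\<^sup>2 \<Longrightarrow> x < 0"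
          by (smt (verit) zero_le_power2)
        ultimately show ?thesis by auto
      qed
      then show ?thesis by (auto simp: dist_norm)
    qed
    also have "emeasure lborel \<dots> = ennreal (pi * max 0 (- x))"
      by (auto simp: emeasure_ball unit_ball_vol_2)
    finally show ?thesis .
  qed
  have R: "emeasure ?R {x<..} = ennreal (pi * max 0 (- x))" for x
  proof -
    have "emeasure ?R {x<..} = (\<integral>\<^sup>+t. ennreal pi * indicator {x<..0} t \<partial>lborel)"
      by (subst emeasure_density) (auto intro!: nn_integral_cong split: split_indicator)
    also have "\<dots> = ennreal pi * emeasure lborel {x<..0}"
      by (subst nn_integral_cmult) auto
    also have "\<dots> = ennreal (pi * max 0 (- x))"
      by (cases "x \<le> 0") (auto simp flip: ennreal_mult)
    finally show ?thesis .
  qed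
  show "emeasure ?L {x<..} < \<infinity>" for x by (simp add: L)
  show "emeasure ?L {x<..} = emeasure ?R {x<..}" for x by (simp add: L R)
qed auto

text \<open>This replaces polar coordinates for radial integrands; the reflection of the real line
  undoes the sign in the preceding law.\<close>

lemma nn_integral_cmod_power2:
  assumes [measurable]: "g \<in> borel_measurable borel"
  shows "(\<integral>\<^sup>+z. g ((cmod z)\<^sup>2) \<partial>lborel) = ennreal pi * (\<integral>\<^sup>+t. g t * indicator {0..} t \<partial>lborel)"
proof -
  have "(\<integral>\<^sup>+z. g ((cmod z)\<^sup>2) \<partial>lborel) = (\<integral>\<^sup>+t. g (- t) \<partial>distr lborel borel (\<lambda>z::complex. - (cmod z)\<^sup>2))"
    by (subst nn_integral_distr) auto
  also have "\<dots> = (\<integral>\<^sup>+t. (ennreal pi * indicator {..0} t) * g (- t) \<partial>lborel)"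
    unfolding distr_lborel_uminus_cmod_power2 by (subst nn_integral_density) auto
  also have "\<dots> = (\<integral>\<^sup>+t. (ennreal pi * indicator {..0} (- t)) * g t \<partial>lborel)"
    by (subst nn_integral_real_affine[where c = "-1" and t = 0]) auto
  also have "\<dots> = (\<integral>\<^sup>+t. ennreal pi * (g t * indicator {0..} t) \<partial>lborel)"
    by (intro nn_integral_cong) (auto split: split_indicator)
  also have "\<dots> = ennreal pi * (\<integral>\<^sup>+t. g t * indicator {0..} t \<partial>lborel)"
    by (subst nn_integral_cmult) auto
  finally show ?thesis .
qed

text \<open>Equal variances \<open>1/2\<close> of real and imaginary part make the product density
  radial, as \<open>nn_integral_cmod_power2\<close> requires.\<close>

lemma CN01_eq: "CN01 = density lborel (\<lambda>z. ennreal (exp (- (cmod z)\<^sup>2) / pi))"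
proof -
  have "normal_density 0 (sqrt (1/2)) a * normal_density 0 (sqrt (1/2)) b = exp (- (a\<^sup>2 + b\<^sup>2)) / pi"
    for a b :: real
    by (simp add: normal_density_def exp_add[symmetric] real_sqrt_mult_self flip: exp_diff)
  then show ?thesis by (simp add: CN01_def cmod_power2)
qed

text \<open>The constant \<open>pi\<close> of the radial integral cancels the normalisation of the
  density, which leaves the exponential law of rate 1.\<close>

lemma emeasure_CN01_cmod_power2_less:
  assumes "0 \<le> s"
  shows "emeasure CN01 {z. (cmod z)\<^sup>2 < s} = ennreal (1 - exp (- s))"
proof -
  have "emeasure CN01 {z. (cmod z)\<^sup>2 < s} =
      (\<integral>\<^sup>+z. ennreal (exp (- (cmod z)\<^sup>2) / pi) * indicator {..<s} ((cmod z)\<^sup>2) \<partial>lborel)"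
    unfolding CN01_eq by (subst emeasure_density) (auto intro!: nn_integral_cong split: split_indicator)
  also have "\<dots> = ennreal pi * (\<integral>\<^sup>+t. ennreal (exp (- t) / pi) * indicator {..<s} t * indicator {0..} t \<partial>lborel)"
    by (rule nn_integral_cmod_power2) measurable
  also have "\<dots> = (\<integral>\<^sup>+t. ennreal pi * (ennreal (exp (- t) / pi) * indicator {..<s} t * indicator {0..} t) \<partial>lborel)"
    by (subst nn_integral_cmult) auto
  also have "\<dots> = (\<integral>\<^sup>+t. ennreal (exp (- t)) * indicator {0..s} t \<partial>lborel)"
  \<comment> \<open>The integrands differ only at the null point \<open>s\<close>; the closed
    interval is the form that the fundamental theorem needs.\<close>
  proof (rule nn_integral_cong_AE)
    show "AE t in lborel. ennreal pi * (ennreal (exp (- t) / pi) * indicator {..<s} t * indicator {0..} t)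
        = ennreal (exp (- t)) * indicator {0..s} t"
      using AE_lborel_singleton[of s]
      by eventually_elim (auto split: split_indicator simp flip: ennreal_mult)
  qed
  also have "\<dots> = ennreal (- exp (- s) - (- exp (- 0)))"
    using assms by (intro nn_integral_FTC_Icc) (auto intro!: derivative_eq_intros)
  finally show ?thesis by simp
qed

text \<open>The factor \<open>pi\<close> cancels against the area \<open>pi * R\<^sup>2\<close> of
  the disc, so the squared radius is uniform on \<open>{0..R\<^sup>2}\<close>.\<close>

lemma nn_integral_uniform_disc:
  assumes R: "0 < R" and g: "continuous_on {0..R\<^sup>2} g" "\<And>t. t \<in> {0..R\<^sup>2} \<Longrightarrow> 0 \<le> g t"
    and [measurable]: "g \<in> borel_measurable borel"
  shows "(\<integral>\<^sup>+z. ennreal (g ((cmod z)\<^sup>2)) \<partial>uniform_measure lborel (cball 0 R))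
           = ennreal (integral {0..R\<^sup>2} g / R\<^sup>2)"
proof -
  have e: "emeasure lborel (cball (0::complex) R) = ennreal (pi * R\<^sup>2)"
    using R by (simp add: emeasure_cball unit_ball_vol_2)
  have "(\<integral>\<^sup>+z. ennreal (g ((cmod z)\<^sup>2)) * indicator (cball 0 R) z \<partial>lborel)
      = (\<integral>\<^sup>+z. ennreal (g ((cmod z)\<^sup>2)) * indicator {..R\<^sup>2} ((cmod z)\<^sup>2) \<partial>lborel)"
    using R by (intro nn_integral_cong) (auto split: split_indicator simp: power2_le_iff_abs_le)
  also have "\<dots> = ennreal pi * (\<integral>\<^sup>+t. ennreal (g t) * indicator {..R\<^sup>2} t * indicator {0..} t \<partial>lborel)"
    by (rule nn_integral_cmod_power2) measurable
  also have "(\<integral>\<^sup>+t. ennreal (g t) * indicator {..R\<^sup>2} t * indicator {0..} t \<partial>lborel)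
      = (\<integral>\<^sup>+t. ennreal (g t) * indicator {0..R\<^sup>2} t \<partial>lborel)"
    by (intro nn_integral_cong) (auto split: split_indicator)
  also have "\<dots> = ennreal (integral {0..R\<^sup>2} g)"
    using g by (intro nn_integral_has_integral_lebesgue') (auto intro!: integrable_integral integrable_continuous_interval)
  finally have i: "(\<integral>\<^sup>+z. ennreal (g ((cmod z)\<^sup>2)) * indicator (cball 0 R) z \<partial>lborel)
      = ennreal pi * ennreal (integral {0..R\<^sup>2} g)" .
  have p: "0 \<le> integral {0..R\<^sup>2} g"
    by (intro integral_nonneg integrable_continuous_interval g)
  show ?thesis
    using R p by (subst nn_integral_uniform_measure)
      (auto simp: e i divide_ennreal simp flip: ennreal_mult)
qed

section \<open>Order statistics and the binomial tail\<close>

text \<open>In a sorted list the elements below \<open>t\<close> form a prefix, so position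
  \<open>i\<close> lies in it iff the prefix is longer than \<open>i\<close>.\<close>

lemma sorted_nth_less_iff:
  fixes xs :: "'a::linorder list"
  assumes "sorted xs" "i < length xs"
  shows "xs ! i < t \<longleftrightarrow> i < length (filter (\<lambda>x. x < t) xs)"
  using assms
proof (induction xs arbitrary: i)
  case (Cons x xs)
  show ?case
  proof (cases "x < t")
    case True
    then show ?thesis using Cons by (cases i) auto
  next
    case False
    have "t \<le> (x # xs) ! i"
      using False Cons.prems by (cases i) (auto, meson leI le_less_trans nth_mem)
    moreover have "filter (\<lambda>x. x < t) (x # xs) = []"
      using False Cons.prems by (auto simp: filter_empty_conv)
    ultimately show ?thesis by (metis leD list.size(3) not_less_zero)
  qed
qed simp

text \<open>Only the sorted list of keys matters, so ties need no special care; distinctness turns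
  the filtered length into a cardinality.\<close>

lemma sort_key_nth_less_iff:
  fixes f :: "'b \<Rightarrow> 'a::linorder"
  assumes "distinct xs" "i < length xs"
  shows "f (sort_key f xs ! i) < t \<longleftrightarrow> i < card {x \<in> set xs. f x < t}"
proof -
  have "f (sort_key f xs ! i) < t \<longleftrightarrow> map f (sort_key f xs) ! i < t"
    using assms by simp
  also have "\<dots> \<longleftrightarrow> i < length (filter (\<lambda>x. x < t) (map f (sort_key f xs)))"
    using assms by (intro sorted_nth_less_iff) auto
  also have "length (filter (\<lambda>x. x < t) (map f (sort_key f xs)))
      = length (filter (\<lambda>x. f x < t) (sort_key f xs))"
    by (simp add: filter_map o_def)
  also have "\<dots> = card (set (filter (\<lambda>x. f x < t) (sort_key f xs)))"
    using assms by (intro distinct_card[symmetric]) simp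
  finally show ?thesis by simp
qed

text \<open>The event is split according to the exact set \<open>S\<close> of indices at which
  \<open>B\<close> holds. Independence makes the probability of each piece depend on
  \<open>card S\<close> alone, and \<open>n_subsets\<close> counts the sets of each size.\<close>

lemma (in prob_space) prob_card_ge:
  assumes I: "finite I" and ind: "indep_vars (\<lambda>_. count_space UNIV) B I"
    and p: "\<And>i. i \<in> I \<Longrightarrow> prob {\<omega> \<in> space M. B i \<omega>} = p"
  shows "prob {\<omega> \<in> space M. k \<le> card {i \<in> I. B i \<omega>}}
           = (\<Sum>j=k..card I. real (card I choose j) * (p ^ j * (1 - p) ^ (card I - j)))"
proof -
  define E where "E S = {\<omega> \<in> space M. {i \<in> I. B i \<omega>} = S}" for S
  have rv: "B i \<in> measurable M (count_space UNIV)" if "i \<in> I" for i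
    using ind that unfolding indep_vars_def by blast
  have E_eq: "E S = {\<omega> \<in> space M. \<forall>i\<in>I. B i \<omega> = (i \<in> S)}" if "S \<subseteq> I" for S
    using that unfolding E_def by blast
  have pE: "prob (E S) = p ^ card S * (1 - p) ^ (card I - card S)" if S: "S \<subseteq> I" for S
  \<comment> \<open>For empty \<open>I\<close> the intersection used below would be
    \<open>UNIV\<close> instead of \<open>space M\<close>.\<close>
  proof (cases "I = {}")
    case True
    then show ?thesis using S by (simp add: E_def prob_space)
  next
    case False
    have "E S = (\<Inter>i\<in>I. B i -` {i \<in> S} \<inter> space M)"
      using False unfolding E_eq[OF S] by auto
    also have "prob \<dots> = (\<Prod>i\<in>I. prob (B i -` {i \<in> S} \<inter> space M))"
      using False I by (intro indep_varsD_finite[OF ind]) auto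
    also have "\<dots> = (\<Prod>i\<in>I. if i \<in> S then p else 1 - p)"
    proof (rule prod.cong[OF refl])
      fix i assume i: "i \<in> I"
      have [measurable]: "B i \<in> measurable M (count_space UNIV)" by (rule rv[OF i])
      have "B i -` {True} \<inter> space M = {\<omega> \<in> space M. B i \<omega>}"
        "B i -` {False} \<inter> space M = {\<omega> \<in> space M. \<not> B i \<omega>}" by auto
      moreover have "prob {\<omega> \<in> space M. \<not> B i \<omega>} = 1 - prob {\<omega> \<in> space M. B i \<omega>}"
        by (rule prob_neg) measurable
      ultimately show "prob (B i -` {i \<in> S} \<inter> space M) = (if i \<in> S then p else 1 - p)"
        using p[OF i] by (cases "i \<in> S") simp_all
    qed
    also have "\<dots> = p ^ card S * (1 - p) ^ (card I - card S)"
      using I S by (simp add: prod.If_cases Int_absorb1 card_Diff_subset finite_subset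
        flip: Diff_eq)
    finally show ?thesis .
  qed
  have mE: "E S \<in> events" if S: "S \<subseteq> I" for S
    unfolding E_eq[OF S]
  proof (rule sets.sets_Collect_finite_All[OF _ I])
    fix i assume "i \<in> I"
    then have [measurable]: "B i \<in> measurable M (count_space UNIV)" by (rule rv)
    show "{\<omega> \<in> space M. B i \<omega> = (i \<in> S)} \<in> events" by measurable
  qed
  define P where "P = {S. S \<subseteq> I \<and> k \<le> card S}"
  have P: "finite P" "P \<subseteq> Pow I" using I by (auto simp: P_def)
  have "{\<omega> \<in> space M. k \<le> card {i \<in> I. B i \<omega>}} = (\<Union>S\<in>P. E S)"
    by (auto simp: P_def E_def)
  also have "prob \<dots> = (\<Sum>S\<in>P. prob (E S))"
    using P mE by (intro finite_measure_finite_Union) (auto simp: disjoint_family_on_def E_def)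
  also have "\<dots> = (\<Sum>S\<in>P. p ^ card S * (1 - p) ^ (card I - card S))"
    using P pE by (intro sum.cong) auto
  also have "\<dots> = (\<Sum>j=k..card I. \<Sum>S\<in>{S \<in> P. card S = j}. p ^ card S * (1 - p) ^ (card I - card S))"
    using P I by (intro sum.group[symmetric]) (auto simp: P_def intro: card_mono)
  also have "\<dots> = (\<Sum>j=k..card I. real (card I choose j) * (p ^ j * (1 - p) ^ (card I - j)))"
  proof (rule sum.cong[OF refl])
    fix j assume "j \<in> {k..card I}"
    then have "{S \<in> P. card S = j} = {S. S \<subseteq> I \<and> card S = j}" by (auto simp: P_def)
    then have "card {S \<in> P. card S = j} = card I choose j" using n_subsets[OF I] by simp
    then show "(\<Sum>S\<in>{S \<in> P. card S = j}. p ^ card S * (1 - p) ^ (card I - card S))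
        = real (card I choose j) * (p ^ j * (1 - p) ^ (card I - j))" by simp
  qed
  finally show ?thesis .
qed

text \<open>Both sides are the incomplete beta integral of \<open>phi M m * t ^ (m - 1) * (1 - t) ^ (M - m)\<close>
  over \<open>{0..x}\<close>: the derivative of the left-hand side telescopes.\<close>

lemma binomial_tail_eq:
  assumes m: "1 \<le> m" "m \<le> M"
  shows "(\<Sum>k=m..M. real (M choose k) * (x ^ k * (1 - x) ^ (M - k)))
    = phi M m * (\<Sum>p=0..M - m. real ((M - m) choose p) * ((-1) ^ p / real (m + p)) * x ^ (m + p))"
    (is "?f x = ?g x")
proof -
  define D where "D y = phi M m * y ^ (m - 1) * (1 - y) ^ (M - m)" for y :: real
  have f: "(?f has_real_derivative D y) (at y)" for y
  proof -
    \<comment> \<open>\<open>T k\<close> comes from differentiating \<open>x ^ k\<close>;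
      differentiating \<open>(1 - x) ^ (M - k)\<close> yields \<open>- T (Suc k)\<close> by the
      absorption identities.\<close>
    define T where "T k = real (M choose k) * real k * y ^ (k - 1) * (1 - y) ^ (M - k)" for k
    have T_Suc: "T (Suc k) = real (M choose k) * real (M - k) * y ^ k * (1 - y) ^ (M - k - 1)"
      if "k \<le> M" for k
    proof -
      have "Suc k * (M choose Suc k) = (M choose k) * (M - k)"
        by (metis binomial_absorption binomial_absorb_comp mult.commute)
      then have "real (Suc k) * real (M choose Suc k) = real (M choose k) * real (M - k)"
        by (metis of_nat_mult)
      then show ?thesis by (simp add: T_def mult.commute)
    qed
    have "(?f has_real_derivative (\<Sum>k=m..M. T k - T (Suc k))) (at y)"
    proof (rule DERIV_sum)
      fix k assume "k \<in> {m..M}"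
      then have k: "k \<le> M" by simp
      show "((\<lambda>x. real (M choose k) * (x ^ k * (1 - x) ^ (M - k))) has_real_derivative
          T k - T (Suc k)) (at y)"
        unfolding T_Suc[OF k] unfolding T_def
        by (auto intro!: derivative_eq_intros simp: algebra_simps)
    qed
    also have "(\<Sum>k=m..M. T k - T (Suc k)) = T m - T (Suc M)"
      using m(2) by (induction M rule: dec_induct) auto
    \<comment> \<open>\<open>T (Suc M)\<close> vanishes because \<open>M choose Suc M\<close> is
      zero.\<close>
    also have "T m - T (Suc M) = D y"
    proof -
      have "real (M choose m) * real m = phi M m"
        using m by (cases m) (simp_all add: phi_def binomial_fact del: of_nat_Suc)
      then show ?thesis by (simp add: T_def D_def)
    qed
    finally show ?thesis .
  qed
  have g: "(?g has_real_derivative D y) (at y)" for y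
  proof -
    have "(?g has_real_derivative
        phi M m * (\<Sum>p=0..M - m. real ((M - m) choose p) * (-1) ^ p * y ^ (m + p - 1))) (at y)"
    proof (intro DERIV_cmult DERIV_sum)
      fix p
      have "((\<lambda>x. c * x ^ k) has_real_derivative c * (real k * y ^ (k - 1))) (at y)" for c k
        by (intro DERIV_cmult) (use DERIV_pow[of k y] in simp)
      from this[of "real ((M - m) choose p) * ((-1) ^ p / real (m + p))" "m + p"]
      show "((\<lambda>x. real ((M - m) choose p) * ((-1) ^ p / real (m + p)) * x ^ (m + p))
          has_real_derivative real ((M - m) choose p) * (-1) ^ p * y ^ (m + p - 1)) (at y)"
        using m by (simp add: mult.assoc del: of_nat_add)
    qed
    also have "(\<Sum>p=0..M - m. real ((M - m) choose p) * (-1) ^ p * y ^ (m + p - 1))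
        = y ^ (m - 1) * (\<Sum>p\<le>M - m. real ((M - m) choose p) * (- y) ^ p * 1 ^ (M - m - p))"
      unfolding sum_distrib_left atLeast0AtMost
    proof (rule sum.cong[OF refl])
      fix p
      have "y ^ (m + p - 1) = y ^ (m - 1) * y ^ p" using m by (simp flip: power_add)
      then show "real ((M - m) choose p) * (-1) ^ p * y ^ (m + p - 1)
          = y ^ (m - 1) * (real ((M - m) choose p) * (- y) ^ p * 1 ^ (M - m - p))"
        by (simp add: power_minus[of y])
    qed
    also have "\<dots> = y ^ (m - 1) * (1 - y) ^ (M - m)"
      by (subst binomial_ring[symmetric]) simp
    finally show ?thesis by (simp add: D_def mult.assoc)
  qed
  \<comment> \<open>Equal derivatives leave a constant difference; it is zero since
    \<open>1 \<le> m\<close> makes every exponent of \<open>x\<close> positive.\<close>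
  have "?f x - ?g x = ?f 0 - ?g 0"
  proof -
    have "((\<lambda>x. ?f x - ?g x) has_real_derivative 0) (at y)" for y
      using DERIV_diff[OF f g] by simp
    then show ?thesis using DERIV_isconst_all[of "\<lambda>x. ?f x - ?g x" x 0] by blast
  qed
  moreover have "?f 0 = 0" using m by (simp add: power_0_left)
  moreover have "?g 0 = 0" using m by (simp add: power_0_left)
  ultimately show ?thesis by linarith
qed

section \<open>Gauss-Chebyshev quadrature\<close>

text \<open>The node \<open>theta U u\<close> is the cosine of the \<open>u\<close>-th midpoint
  angle \<open>t\<close> in \<open>{0..pi}\<close>. There
  \<open>sqrt (1 - (theta U u)\<^sup>2)\<close> is \<open>sin t\<close>, and \<open>gc_b U u\<close>
  is the mesh width times the normalised Jacobian of the squared radius.\<close>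

lemma gauss_chebyshev_disc_tendsto:
  assumes R: "0 < R" and g: "continuous_on {0..R\<^sup>2} g"
  shows "(\<lambda>U. \<Sum>u=1..U. gc_b U u * g ((R / 2 * (theta U u + 1))\<^sup>2))
           \<longlonglongrightarrow> integral {0..R\<^sup>2} g / R\<^sup>2"
proof -
  define r where "r t = (R / 2 * (cos t + 1))\<^sup>2" for t
  \<comment> \<open>The squared radius \<open>r\<close> falls from \<open>R\<^sup>2\<close> to 0 as
    \<open>t\<close> runs from 0 to \<open>pi\<close>; the minus sign corrects the
    orientation.\<close>
  define F where "F t = - (integral {0..r t} g / R\<^sup>2)" for t
  define f where "f t = sin t * (cos t + 1) / 2 * g (r t)" for t
  have r_range: "r t \<in> {0..R\<^sup>2}" for t
  proof -
    have "0 \<le> cos t + 1" "cos t + 1 \<le> 2"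
      using cos_ge_minus_one[of t] cos_le_one[of t] by linarith+
    then have "0 \<le> R / 2 * (cos t + 1)" "R / 2 * (cos t + 1) \<le> R"
      using R by auto
    then show ?thesis by (auto simp: r_def intro: power_mono)
  qed
  have "(F has_real_derivative f t) (at t within {0..pi})" for t
  proof -
    \<comment> \<open>\<open>g\<close> is continuous only on \<open>{0..R\<^sup>2}\<close>, so the
      derivative is taken within the image of \<open>r\<close>, which lies in that interval.\<close>
    have "((\<lambda>y. integral {0..y} g) has_real_derivative g (r t)) (at (r t) within r ` {0..pi})"
      using r_range by (intro DERIV_subset[OF integral_has_real_derivative[OF g]]) auto
    moreover have "(r has_real_derivative 2 * (R / 2 * (cos t + 1)) * (R / 2 * (- sin t)))
        (at t within {0..pi})"
      unfolding r_def by (auto intro!: derivative_eq_intros)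
    ultimately have "((\<lambda>y. integral {0..y} g) \<circ> r has_real_derivative
        g (r t) * (2 * (R / 2 * (cos t + 1)) * (R / 2 * (- sin t)))) (at t within {0..pi})"
      by (rule DERIV_image_chain)
    from DERIV_cdivide[OF DERIV_minus[OF this], of "R\<^sup>2"]
    have "(F has_real_derivative
        - (g (r t) * (2 * (R / 2 * (cos t + 1)) * (R / 2 * (- sin t)))) / R\<^sup>2) (at t within {0..pi})"
      by (simp add: F_def[abs_def] o_def)
    also have "- (g (r t) * (2 * (R / 2 * (cos t + 1)) * (R / 2 * (- sin t)))) / R\<^sup>2 = f t"
      using R by (simp add: f_def field_simps power2_eq_square)
    finally show ?thesis .
  qed
  moreover have "continuous_on {0..pi} f"
    unfolding f_def using r_range
    by (intro continuous_intros continuous_on_compose2[OF g]) (auto simp: r_def intro!: continuous_intros)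
  ultimately have "(\<lambda>U. (pi - 0) / real U *
      (\<Sum>u=1..U. f (0 + (2 * real u - 1) / (2 * real U) * (pi - 0)))) \<longlonglongrightarrow> F pi - F 0"
    by (intro midpoint_sums_tendsto) auto
  moreover have "F pi - F 0 = integral {0..R\<^sup>2} g / R\<^sup>2"
    by (simp add: F_def r_def)
  moreover have "(pi - 0) / real U * (\<Sum>u=1..U. f (0 + (2 * real u - 1) / (2 * real U) * (pi - 0)))
      = (\<Sum>u=1..U. gc_b U u * g ((R / 2 * (theta U u + 1))\<^sup>2))" for U
    unfolding sum_distrib_left
  proof (rule sum.cong[OF refl])
    fix u assume u: "u \<in> {1..U}"
    define t where "t = (2 * real u - 1) / (2 * real U) * pi"
    have "0 \<le> (2 * real u - 1) / (2 * real U)" "(2 * real u - 1) / (2 * real U) \<le> 1"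
      using u by (auto simp: field_simps)
    then have "0 \<le> t" "t \<le> pi"
      unfolding t_def using mult_right_mono[of _ 1 pi] by (auto simp del: times_divide_eq_left)
    then have "sqrt (1 - (cos t)\<^sup>2) = sin t"
      by (simp add: sin_ge_zero flip: sin_squared_eq)
    moreover have "theta U u = cos t" by (simp add: theta_def t_def)
    moreover have "pi / real U * (a * b / 2 * c) = pi / (2 * real U) * a * b * c" for a b c
      by simp
    ultimately show "(pi - 0) / real U * f (0 + (2 * real u - 1) / (2 * real U) * (pi - 0))
        = gc_b U u * g ((R / 2 * (theta U u + 1))\<^sup>2)"
      by (simp only: gc_b_def diff_zero add_0_left t_def[symmetric] f_def r_def)
  qed
  ultimately show ?thesis by simp
qed

section \<open>Law of one gain and the outage threshold\<close>

text \<open>By independence the joint law is a product. For a fixed location the slice is an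
  exponential distribution function, which is then averaged over the disc; \<open>sqrt t\<close>
  appears because \<open>t\<close> is the squared radius.\<close>

lemma (in prob_space) prob_faded_gain_less:
  assumes ind: "indep_var borel Z borel H"
    and Z: "distr M borel Z = uniform_measure lborel (cball 0 R)"
    and H: "distr M borel H = CN01"
    and pos: "0 < R" "0 < \<eta>" "0 < \<alpha>" "0 \<le> \<tau>"
  shows "prob {\<omega> \<in> space M. \<eta> * (cmod (H \<omega>))\<^sup>2 / (1 + cmod (Z \<omega>) powr \<alpha>) < \<tau>}
    = integral {0..R\<^sup>2} (\<lambda>t. 1 - exp (- (\<tau> * (1 + sqrt t powr \<alpha>) / \<eta>))) / R\<^sup>2" (is "_ = ?I")
proof -
  define g where "g t = 1 - exp (- (\<tau> * (1 + sqrt t powr \<alpha>) / \<eta>))" for t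
  define A where "A = {(x, z). \<eta> * (cmod z)\<^sup>2 / (1 + cmod x powr \<alpha>) < \<tau>}"
  have A[measurable]: "A \<in> sets (borel \<Otimes>\<^sub>M borel)"
  proof -
    have "A = {p \<in> space (borel \<Otimes>\<^sub>M borel).
        \<eta> * (cmod (snd p))\<^sup>2 / (1 + cmod (fst p) powr \<alpha>) < \<tau>}"
      by (auto simp: A_def space_pair_measure)
    also have "\<dots> \<in> sets (borel \<Otimes>\<^sub>M borel)"
      by measurable
    finally show ?thesis .
  qed
  have [measurable]: "random_variable borel Z" "random_variable borel H"
    using ind by (auto dest: indep_var_rv1 indep_var_rv2)
  \<comment> \<open>As the law of \<open>H\<close>, \<open>CN01\<close> has total mass 1; this
    supplies the finiteness needed to integrate slices.\<close>
  interpret H: prob_space CN01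
    unfolding H[symmetric] by (rule prob_space_distr) measurable
  have sets_CN: "sets CN01 = sets borel"
    by (simp add: CN01_def)
  have g_nonneg: "0 \<le> g t" for t
    using pos by (simp add: g_def)
  have g_cont: "continuous_on {0..R\<^sup>2} g"
    unfolding g_def using pos by (auto intro!: continuous_intros continuous_on_powr')
  have "emeasure M {\<omega> \<in> space M. \<eta> * (cmod (H \<omega>))\<^sup>2 / (1 + cmod (Z \<omega>) powr \<alpha>) < \<tau>}
      = emeasure (distr M (borel \<Otimes>\<^sub>M borel) (\<lambda>\<omega>. (Z \<omega>, H \<omega>))) A"
    by (subst emeasure_distr[OF _ A]) (measurable, auto intro!: arg_cong[where f = "emeasure M"] simp: A_def)
  also have "distr M (borel \<Otimes>\<^sub>M borel) (\<lambda>\<omega>. (Z \<omega>, H \<omega>)) = uniform_measure lborel (cball 0 R) \<Otimes>\<^sub>M CN01"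
    using ind unfolding indep_var_distribution_eq Z H by simp
  also have "emeasure \<dots> A = (\<integral>\<^sup>+x. emeasure CN01 (Pair x -` A) \<partial>uniform_measure lborel (cball 0 R))"
    using A by (intro H.emeasure_pair_measure_alt) (simp cong: sets_pair_measure_cong add: sets_CN)
  also have "\<dots> = (\<integral>\<^sup>+x. ennreal (g ((cmod x)\<^sup>2)) \<partial>uniform_measure lborel (cball 0 R))"
  proof (rule nn_integral_cong)
    fix x :: complex
    have "0 < 1 + cmod x powr \<alpha>" by (simp add: add_pos_nonneg)
    then have "Pair x -` A = {z. (cmod z)\<^sup>2 < \<tau> * (1 + cmod x powr \<alpha>) / \<eta>}"
      using pos by (auto simp: A_def field_simps)
    then show "emeasure CN01 (Pair x -` A) = ennreal (g ((cmod x)\<^sup>2))"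
      using pos by (simp add: emeasure_CN01_cmod_power2_less g_def)
  qed
  also have "\<dots> = ennreal (integral {0..R\<^sup>2} g / R\<^sup>2)"
    using pos g_cont g_nonneg by (intro nn_integral_uniform_disc) (auto simp: g_def)
  also have "integral {0..R\<^sup>2} g / R\<^sup>2 = ?I" by (simp add: g_def[abs_def])
  finally show ?thesis
    using g_nonneg
    by (intro measure_eq_emeasure_eq_ennreal)
      (auto simp flip: g_def intro!: divide_nonneg_nonneg integral_nonneg integrable_continuous_interval g_cont)
qed

lemma sqnorm_1: "sqnorm (Suc 0) v = (cmod (v (Suc 0)))\<^sup>2"
  by (simp add: sqnorm_def)

lemma sqnorm_1_channel:
  assumes "0 \<le> \<eta>"
  shows "sqnorm (Suc 0) (channel \<eta> \<alpha> X h j \<omega>) = \<eta> * (cmod (h j (Suc 0) \<omega>))\<^sup>2 / (1 + cmod (X j \<omega>) powr \<alpha>)"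
  using assms
  by (simp add: sqnorm_1 channel_def norm_mult norm_divide power_mult_distrib power_divide)

text \<open>Both columns have the entry 1, so signal and interference carry the same gain. Clearing
  denominators gives a linear inequality in it, and \<open>\<epsilon> * a' < a\<close> keeps its
  coefficient positive.\<close>

lemma sinr_1_less_iff:
  assumes "g (Suc 0) = 1" "g' (Suc 0) = 1" "0 < \<rho>" "0 \<le> a'" "\<epsilon> * a' < a"
  shows "sinr (Suc 0) \<rho> v g a g' a' < \<epsilon> \<longleftrightarrow> sqnorm (Suc 0) v < \<epsilon> / (\<rho> * (a - \<epsilon> * a'))"
proof -
  define y where "y = sqnorm (Suc 0) v"
  have y: "0 \<le> y" by (simp add: y_def sqnorm_1)
  have "0 < \<rho> * y * a' + 1" using y assms by (simp add: add_nonneg_pos)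
  moreover have "sqnorm (Suc 0) (diag_mult v g) = y" "sqnorm (Suc 0) (diag_mult v g') = y"
    using assms by (auto simp: y_def sqnorm_1 diag_mult_def)
  ultimately have "sinr (Suc 0) \<rho> v g a g' a' < \<epsilon> \<longleftrightarrow> \<rho> * y * a < \<epsilon> * (\<rho> * y * a' + 1)"
    by (simp add: sinr_def pos_divide_less_eq)
  also have "\<dots> \<longleftrightarrow> y * (\<rho> * (a - \<epsilon> * a')) < \<epsilon>" by (auto simp: algebra_simps)
  also have "\<dots> \<longleftrightarrow> y < \<epsilon> / (\<rho> * (a - \<epsilon> * a'))"
    using assms by (simp add: pos_less_divide_eq)
  finally show ?thesis by (simp add: y_def)
qed

lemma (in prob_space) indep_var_if_indep_vars:
  assumes ind: "indep_vars M' X I" and ij: "i \<in> I" "j \<in> I" "i \<noteq> j"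
  shows "indep_var (M' i) (X i) (M' j) (X j)"
proof -
  have "indep_var (PiM {i} M') (\<lambda>\<omega>. \<lambda>k\<in>{i}. X k \<omega>) (PiM {j} M') (\<lambda>\<omega>. \<lambda>k\<in>{j}. X k \<omega>)"
    using ij by (intro indep_var_restrict[OF ind]) auto
  then have "indep_var (M' i) ((\<lambda>x. x i) \<circ> (\<lambda>\<omega>. \<lambda>k\<in>{i}. X k \<omega>))
      (M' j) ((\<lambda>x. x j) \<circ> (\<lambda>\<omega>. \<lambda>k\<in>{j}. X k \<omega>))"
    by (rule indep_var_compose) auto
  then show ?thesis by (simp add: o_def)
qed

section \<open>Gains of the users in the network\<close>

context downlink_noma
begin

text \<open>Location and fading of user \<open>j\<close> form a block \<open>J j\<close>. The blocks
  are disjoint, and each event depends on one block only.\<close>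

lemma indep_vars_gain_less:
  "indep_vars (\<lambda>_. count_space UNIV)
     (\<lambda>j \<omega>. \<eta> * (cmod (h j 1 \<omega>))\<^sup>2 / (1 + cmod (X j \<omega>) powr \<alpha>) < \<tau>) {1..M}"
proof -
  define J where "J j = {Inl j, Inr (j, 1 :: nat)}" for j :: nat
  define V where "V = case_sum X (\<lambda>(j, k). h j k)"
  define B where "B j f = (\<eta> * (cmod (f (Inr (j, 1))))\<^sup>2 / (1 + cmod (f (Inl j)) powr \<alpha>) < \<tau>)"
    for j :: nat and f :: "nat + nat \<times> nat \<Rightarrow> complex"
  have "indep_vars (\<lambda>j. PiM (J j) (\<lambda>_. borel)) (\<lambda>j \<omega>. restrict (\<lambda>i. V i \<omega>) (J j)) {1..M}"
    unfolding V_def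
    by (rule indep_vars_restrict[OF indep]) (use sizes in \<open>auto simp: J_def disjoint_family_on_def\<close>)
  then have "indep_vars (\<lambda>_. count_space UNIV) (\<lambda>j \<omega>. B j (restrict (\<lambda>i. V i \<omega>) (J j))) {1..M}"
  proof (rule indep_vars_compose2)
    fix j
    have [measurable]: "(\<lambda>f. f (Inl j)) \<in> PiM (J j) (\<lambda>_. borel :: complex measure) \<rightarrow>\<^sub>M borel"
      "(\<lambda>f. f (Inr (j, 1))) \<in> PiM (J j) (\<lambda>_. borel :: complex measure) \<rightarrow>\<^sub>M borel"
      by (auto simp: J_def)
    show "B j \<in> PiM (J j) (\<lambda>_. borel) \<rightarrow>\<^sub>M count_space UNIV"
      unfolding B_def[abs_def] by measurable
  qed
  then show ?thesis by (simp add: B_def J_def V_def)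
qed

lemma prob_gain_less:
  assumes "j \<in> {1..M}" "0 \<le> \<tau>"
  shows "prob {\<omega> \<in> space \<Omega>. \<eta> * (cmod (h j 1 \<omega>))\<^sup>2 / (1 + cmod (X j \<omega>) powr \<alpha>) < \<tau>}
    = integral {0..R\<^sub>D\<^sup>2} (\<lambda>t. 1 - exp (- (\<tau> * (1 + sqrt t powr \<alpha>) / \<eta>))) / R\<^sub>D\<^sup>2"
proof (rule prob_faded_gain_less)
  show "indep_var borel (X j) borel (h j 1)"
    using indep_var_if_indep_vars[OF indep, of "Inl j" "Inr (j, 1)"] assms sizes
    by (simp add: InlI InrI)
qed (use assms positive sizes location fading in auto)

text \<open>User labels start at 1 and list positions at 0, which turns the strict bound on
  \<open>i - 1\<close> into \<open>i \<le>\<close> the count.\<close>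

lemma ordered_sqnorm_less_iff:
  assumes "i \<in> {1..M}"
  shows "sqnorm K (ordered_channel M K \<eta> \<alpha> X h i \<omega>) < t
    \<longleftrightarrow> i \<le> card {j \<in> {1..M}. sqnorm K (channel \<eta> \<alpha> X h j \<omega>) < t}"
proof -
  have "i - 1 < length [1..<Suc M]" using assms by auto
  then have "sqnorm K (ordered_channel M K \<eta> \<alpha> X h i \<omega>) < t
      \<longleftrightarrow> i - 1 < card {j \<in> set [1..<Suc M]. sqnorm K (channel \<eta> \<alpha> X h j \<omega>) < t}"
    unfolding ordered_channel_def by (intro sort_key_nth_less_iff) auto
  also have "set [1..<Suc M] = {1..M}" by auto
  finally show ?thesis using assms by auto
qed

end

text \<open>The approximation is rendered as convergence to the exact outage probability as the
  number \<open>U\<close> of quadrature terms grows.\<close>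

theorem corollary1:
  fixes \<Omega> :: "'w measure" and M K m n :: nat
    and R\<^sub>D \<eta> \<alpha> \<rho> a\<^sub>m a\<^sub>n R\<^sub>m \<epsilon>\<^sub>m \<tau> :: real
    and X :: "nat \<Rightarrow> 'w \<Rightarrow> complex"
    and h :: "nat \<Rightarrow> nat \<Rightarrow> 'w \<Rightarrow> complex"
    and G :: "nat \<Rightarrow> nat \<Rightarrow> real"
  assumes "downlink_noma \<Omega> M K R\<^sub>D \<eta> \<alpha> \<rho> X h G m n a\<^sub>m a\<^sub>n"
    and "K = 1"
    and "0 \<le> R\<^sub>m" and "\<epsilon>\<^sub>m = 2 powr R\<^sub>m - 1"
    and "a\<^sub>m > \<epsilon>\<^sub>m * a\<^sub>n" and "\<tau> = \<epsilon>\<^sub>m / (\<rho> * (a\<^sub>m - \<epsilon>\<^sub>m * a\<^sub>n))"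
  shows "(\<lambda>U. phi M m * (\<Sum>p=0..M - m. real ((M - m) choose p) * ((-1) ^ p / real (m + p)) *
             (\<Sum>u=1..U. gc_b U u * (1 - exp (- (\<tau> * gc_c R\<^sub>D \<alpha> U u / \<eta>)))) ^ (m + p)))
         \<longlonglongrightarrow> measure \<Omega> {\<omega> \<in> space \<Omega>.
             sinr K \<rho> (ordered_channel M K \<eta> \<alpha> X h m \<omega>) (\<lambda>k. G k m) a\<^sub>m (\<lambda>k. G k n) a\<^sub>n < \<epsilon>\<^sub>m}"
proof -
  interpret downlink_noma \<Omega> M K R\<^sub>D \<eta> \<alpha> \<rho> X h G m n a\<^sub>m a\<^sub>n by fact
  define g where "g t = 1 - exp (- (\<tau> * (1 + sqrt t powr \<alpha>) / \<eta>))" for t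
  define F where "F = integral {0..R\<^sub>D\<^sup>2} g / R\<^sub>D\<^sup>2"
  have "0 \<le> \<epsilon>\<^sub>m" using assms(3,4) by (simp add: ge_one_powr_ge_zero)
  then have \<tau>: "0 \<le> \<tau>" using assms(5,6) positive by simp
  \<comment> \<open>With one subcarrier, a nonzero column must have its single entry equal to
    1.\<close>
  have G: "G 1 m = 1" "G 1 n = 1"
    using spreading(2)[of m] spreading(2)[of n] pair assms(2) by auto
  have outage: "sinr K \<rho> (ordered_channel M K \<eta> \<alpha> X h m \<omega>) (\<lambda>k. G k m) a\<^sub>m (\<lambda>k. G k n) a\<^sub>n < \<epsilon>\<^sub>m
      \<longleftrightarrow> m \<le> card {j \<in> {1..M}. \<eta> * (cmod (h j 1 \<omega>))\<^sup>2 / (1 + cmod (X j \<omega>) powr \<alpha>) < \<tau>}" for \<omega>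
    using ordered_sqnorm_less_iff[of m \<omega> \<tau>] G assms(2,5,6) pair positive power
    by (simp add: sinr_1_less_iff sqnorm_1_channel)
  have "measure \<Omega> {\<omega> \<in> space \<Omega>.
      sinr K \<rho> (ordered_channel M K \<eta> \<alpha> X h m \<omega>) (\<lambda>k. G k m) a\<^sub>m (\<lambda>k. G k n) a\<^sub>n < \<epsilon>\<^sub>m}
      = (\<Sum>k=m..M. real (M choose k) * (F ^ k * (1 - F) ^ (M - k)))"
    unfolding outage
    using prob_card_ge[OF _ indep_vars_gain_less[of \<tau>], of F m] prob_gain_less[of _ \<tau>] \<tau>
    by (simp add: F_def g_def[abs_def])
  also have "\<dots> = phi M m * (\<Sum>p=0..M - m. real ((M - m) choose p) * ((-1) ^ p / real (m + p)) * F ^ (m + p))"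
    using pair by (intro binomial_tail_eq) auto
  finally have prob_eq: "measure \<Omega> {\<omega> \<in> space \<Omega>.
      sinr K \<rho> (ordered_channel M K \<eta> \<alpha> X h m \<omega>) (\<lambda>k. G k m) a\<^sub>m (\<lambda>k. G k n) a\<^sub>n < \<epsilon>\<^sub>m} = \<dots>" .
  have "continuous_on {0..R\<^sub>D\<^sup>2} g"
    unfolding g_def using positive by (auto intro!: continuous_intros continuous_on_powr')
  from gauss_chebyshev_disc_tendsto[OF positive(1) this]
  have "(\<lambda>U. \<Sum>u=1..U. gc_b U u * g ((R\<^sub>D / 2 * (theta U u + 1))\<^sup>2)) \<longlonglongrightarrow> F"
    by (simp add: F_def)
  \<comment> \<open>The node radius is nonnegative, so the square root in \<open>g\<close> returns
    it unchanged and \<open>gc_c\<close> appears.\<close>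
  moreover have "g ((R\<^sub>D / 2 * (theta U u + 1))\<^sup>2) = 1 - exp (- (\<tau> * gc_c R\<^sub>D \<alpha> U u / \<eta>))" for U u
  proof -
    have "- 1 \<le> theta U u" unfolding theta_def by (rule cos_ge_minus_one)
    then have "0 \<le> R\<^sub>D / 2 * (theta U u + 1)" using positive(1) by simp
    then show ?thesis by (simp only: g_def gc_c_def real_sqrt_abs abs_of_nonneg)
  qed
  ultimately have "(\<lambda>U. \<Sum>u=1..U. gc_b U u * (1 - exp (- (\<tau> * gc_c R\<^sub>D \<alpha> U u / \<eta>)))) \<longlonglongrightarrow> F"
    by simp
  \<comment> \<open>The outage probability is a fixed polynomial in \<open>F\<close>, so the limit
    passes through it by continuity.\<close>
  then show ?thesis
    unfolding prob_eq by (intro tendsto_intros)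
qed

end
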